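(* For any $n$, there exists a graphic matroid $M$ with $n$ elements and a total ordering $\mathcal{O}$ of its elements such that the convex hull of the indicator vectors (in $\mathbb{R}^n$) of all NBC bases of $M$ has an edge of $\ell_2$ length at least $\Omega(\sqrt{n})$.
   Context: A graphic matroid is defined on the edge set of a graph, with independent sets the forests; its circuits are the cycles. Given a total ordering $\mathcal{O}$ of the elements, a broken circuit is a set $C\setminus\{e\}$ with $C$ a circuit and $e$ the smallest element of $C$ under $\mathcal{O}$. An NBC basis is a basis (maximal independent set) containing no broken circuit. An edge of a polytope is a one-dimensional face. *)

theory Defs
  imports "HOL-Analysis.Analysis" "HOL-Analysis.Finite_Function_Topology"
begin

section \<open>Graphs and graphic matroids\<close>

text \<open>As usual for graphic matroids, parallel edges and loops are allowed: \<open>ends e\<close> is the set of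
  endpoints of the edge \<open>e\<close>, a singleton exactly for a loop.\<close>

definition graph :: "'v set \<Rightarrow> 'e set \<Rightarrow> ('e \<Rightarrow> 'v set) \<Rightarrow> bool" where
  "graph V E ends \<longleftrightarrow> finite V \<and> finite E \<and>
     (\<forall>e\<in>E. ends e \<subseteq> V \<and> (card (ends e) = 1 \<or> card (ends e) = 2))"

text \<open>The edges \<open>es\<close> run around the distinct vertices \<open>vs\<close>. A loop is a cycle of length 1,
  a pair of parallel edges is a cycle of length 2 (whence the separate requirement that \<open>es\<close> be
  distinct).\<close>

definition cycle :: "('e \<Rightarrow> 'v set) \<Rightarrow> 'e set \<Rightarrow> bool" where
  "cycle ends C \<longleftrightarrow> (\<exists>vs es. vs \<noteq> [] \<and> length es = length vs \<and> distinct vs \<and> distinct es \<and> set es = C \<and>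
     (\<forall>i<length vs. ends (es ! i) = {vs ! i, vs ! (Suc i mod length vs)}))"

definition forest :: "('e \<Rightarrow> 'v set) \<Rightarrow> 'e set \<Rightarrow> bool" where
  "forest ends F \<longleftrightarrow> (\<nexists>C. C \<subseteq> F \<and> cycle ends C)"

text \<open>A matroid is given by its ground set \<open>E\<close> and its family \<open>I\<close> of independent sets.
  As graphs are finite, vertices may be taken to be natural numbers.\<close>

definition graphic_matroid :: "'e set \<Rightarrow> 'e set set \<Rightarrow> bool" where
  "graphic_matroid E I \<longleftrightarrow>
     (\<exists>(V :: nat set) ends. graph V E ends \<and> I = {F. F \<subseteq> E \<and> forest ends F})"

section \<open>NBC bases\<close>

definition basis :: "'e set set \<Rightarrow> 'e set \<Rightarrow> bool" where
  "basis I B \<longleftrightarrow> B \<in> I \<and> (\<forall>A\<in>I. B \<subseteq> A \<longrightarrow> A = B)"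

definition circuit :: "'e set \<Rightarrow> 'e set set \<Rightarrow> 'e set \<Rightarrow> bool" where
  "circuit E I C \<longleftrightarrow> C \<subseteq> E \<and> C \<notin> I \<and> (\<forall>D. D \<subset> C \<longrightarrow> D \<in> I)"

text \<open>In the following, \<open>(a, b) \<in> r\<close> means that \<open>a\<close> is at most \<open>b\<close> in the ordering \<open>r\<close>.\<close>

definition broken_circuit :: "'e set \<Rightarrow> 'e set set \<Rightarrow> 'e rel \<Rightarrow> 'e set \<Rightarrow> bool" where
  "broken_circuit E I r S \<longleftrightarrow>
     (\<exists>C e. circuit E I C \<and> e \<in> C \<and> (\<forall>f\<in>C. (e, f) \<in> r) \<and> S = C - {e})"

definition nbc_basis :: "'e set \<Rightarrow> 'e set set \<Rightarrow> 'e rel \<Rightarrow> 'e set \<Rightarrow> bool" where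
  "nbc_basis E I r B \<longleftrightarrow> basis I B \<and> (\<nexists>S. broken_circuit E I r S \<and> S \<subseteq> B)"

section \<open>The NBC polytope and its edges\<close>

text \<open>For \<open>E\<close> with \<open>n\<close> elements, the space of real vectors with coordinates in \<open>E\<close> is the subspace of
  \<^typ>\<open>'e \<Rightarrow>\<^sub>0 real\<close> of the vectors with support in \<open>E\<close>. This lets the dimension \<open>n\<close> vary
  within one formula.\<close>

definition indicator_vec :: "'e set \<Rightarrow> ('e \<Rightarrow>\<^sub>0 real)" where
  "indicator_vec B = (\<Sum>e\<in>B. Poly_Mapping.single e 1)"

lemma lookup_indicator_vec:
  assumes "finite B"
  shows "Poly_Mapping.lookup (indicator_vec B) e = indicator B e"
  using assms by (simp add: indicator_vec_def lookup_sum lookup_single when_def indicator_def)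

definition nbc_polytope :: "'e set \<Rightarrow> 'e set set \<Rightarrow> 'e rel \<Rightarrow> ('e \<Rightarrow>\<^sub>0 real) set" where
  "nbc_polytope E I r = convex hull (indicator_vec ` {B. nbc_basis E I r B})"

text \<open>The library's \<^const>\<open>edge_of\<close> and \<^const>\<open>aff_dim\<close> are confined to Euclidean spaces. The second
  conjunct below is the definition of affine dimension 1, unfolded.\<close>

definition is_edge_of :: "'a::real_vector set \<Rightarrow> 'a set \<Rightarrow> bool" where
  "is_edge_of F P \<longleftrightarrow> F face_of P \<and>
     (\<exists>B. affine hull B = affine hull F \<and> \<not> affine_dependent B \<and> card B = 2)"

lemma is_edge_of_iff_edge_of:
  fixes F P :: "'a::euclidean_space set"
  shows "is_edge_of F P \<longleftrightarrow> F edge_of P"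
proof -
  have "(\<exists>B. affine hull B = affine hull F \<and> \<not> affine_dependent B \<and> card B = 2) \<longleftrightarrow> aff_dim F = 1"
  proof
    assume "\<exists>B. affine hull B = affine hull F \<and> \<not> affine_dependent B \<and> card B = 2"
    then obtain B where "affine hull B = affine hull F" "\<not> affine_dependent B" "card B = 2"
      by blast
    then have "int (card B) = aff_dim F + 1"
      using aff_dim_unique by blast
    with \<open>card B = 2\<close> show "aff_dim F = 1" by simp
  next
    assume "aff_dim F = 1"
    moreover obtain B where "affine hull B = affine hull F" "\<not> affine_dependent B"
      "int (card B) = aff_dim F + 1"
      using aff_dim_basis_exists[of F] by blast
    ultimately show "\<exists>B. affine hull B = affine hull F \<and> \<not> affine_dependent B \<and> card B = 2"
      by (intro exI[of _ B]) auto
  qed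
  then show ?thesis by (simp add: is_edge_of_def edge_of_def)
qed

text \<open>The library's metric on \<^typ>\<open>'e \<Rightarrow>\<^sub>0 real\<close> is the \<open>\<ell>\<^sub>1\<close> metric, so the Euclidean
  distance is defined separately.\<close>

definition l2_dist :: "'e set \<Rightarrow> ('e \<Rightarrow>\<^sub>0 real) \<Rightarrow> ('e \<Rightarrow>\<^sub>0 real) \<Rightarrow> real" where
  "l2_dist E u v = L2_set (\<lambda>e. Poly_Mapping.lookup u e - Poly_Mapping.lookup v e) E"

end

theory Submission
  imports Defs
begin

text \<open>Join a hub to \<open>m\<close> pairs of vertices by spokes \<open>a\<^sub>i\<close>, \<open>b\<^sub>i\<close>, add an edge \<open>t\<^sub>i\<close>
  closing each pair to a triangle, and for each \<open>i\<close> (modulo \<open>m\<close>) an edge \<open>s\<^sub>i\<close> closing \<open>a\<^sub>i\<close>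
  and \<open>b\<^sub>i\<^sub>+\<^sub>1\<close> to a triangle; order the edges as all \<open>t\<close>, then all \<open>s\<close>, then all spokes.
  Consider the face of the NBC polytope on which every \<open>t\<^sub>i\<close> and exactly one spoke of each pair is
  used and no \<open>s\<^sub>i\<close>. As \<open>s\<^sub>i\<close> is the smallest edge of its triangle, \<open>{a\<^sub>i, b\<^sub>i\<^sub>+\<^sub>1}\<close> is a broken
  circuit, so \<open>a\<^sub>i\<close> forces \<open>a\<^sub>i\<^sub>+\<^sub>1\<close>. Going around cyclically, only the choices of all \<open>a\<^sub>i\<close> or
  all \<open>b\<^sub>i\<close> remain: the face is an edge, whose ends differ in \<open>2m\<close> of the about \<open>4m\<close>
  coordinates.\<close>

section \<open>Edges of convex hulls\<close>

text \<open>On the hull \<open>f\<close> has maximum \<open>c\<close>, attained exactly on the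
  segment. A convex combination with positive weights attains a maximum only if both of its points
  do.\<close>

lemma closed_segment_face_of_convex_hull:
  fixes f :: "'a::real_vector \<Rightarrow> real"
  assumes "linear f" and uv: "u \<in> S" "v \<in> S" "f u = c" "f v = c"
    and less: "\<And>x. x \<in> S \<Longrightarrow> x \<noteq> u \<Longrightarrow> x \<noteq> v \<Longrightarrow> f x < c"
  shows "closed_segment u v face_of convex hull S"
proof -
  interpret linear f by fact
  have seg: "f x = c" if x: "x \<in> closed_segment u v" for x
  proof -
    obtain t where "x = (1 - t) *\<^sub>R u + t *\<^sub>R v"
      using x unfolding closed_segment_def by blast
    then have "f x = (1 - t) * c + t * c" using uv by (simp add: add scaleR)
    then show ?thesis by (simp add: algebra_simps)
  qed
  \<comment> \<open>\<open>K\<close> is a convex set containing \<open>S\<close>, which avoids handling convex combinations explicitly.\<close>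
  define K where "K = {x. f x < c} \<union> closed_segment u v"
  have K: "f x \<le> c" "f x = c \<Longrightarrow> x \<in> closed_segment u v" if "x \<in> K" for x
    using that seg[of x] by (auto simp: K_def)
  have "convex K"
    unfolding convex_alt
  proof (intro ballI allI impI)
    fix x y and t :: real
    assume x: "x \<in> K" and y: "y \<in> K" and t: "0 \<le> t \<and> t \<le> 1"
    define z where "z = (1 - t) *\<^sub>R x + t *\<^sub>R y"
    have fz: "f z = (1 - t) * f x + t * f y"
      by (simp add: z_def add scaleR)
    consider "t = 0" | "t = 1" | "0 < t" "t < 1" using t by linarith
    then have "z \<in> K"
    proof cases
      case 1 then show ?thesis using x by (simp add: z_def)
    next
      case 2 then show ?thesis using y by (simp add: z_def)
    next
      case 3
      show ?thesis
      proof (cases "f x = c \<and> f y = c")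
        case True
        then have "z \<in> closed_segment u v"
          using K(2)[OF x] K(2)[OF y] t convex_closed_segment[of u v]
          unfolding convex_alt z_def by blast
        then show ?thesis by (simp add: K_def)
      next
        case False
        have "(1 - t) * (c - f x) \<ge> 0" "t * (c - f y) \<ge> 0"
          using 3 K(1)[OF x] K(1)[OF y] by auto
        moreover have "(1 - t) * (c - f x) > 0 \<or> t * (c - f y) > 0"
          using False 3 K(1)[OF x] K(1)[OF y] by (auto simp: less_le)
        ultimately have "(1 - t) * (c - f x) + t * (c - f y) > 0" by linarith
        then have "f z < c" unfolding fz by (simp add: algebra_simps)
        then show ?thesis by (simp add: K_def)
      qed
    qed
    then show "(1 - t) *\<^sub>R x + t *\<^sub>R y \<in> K" by (simp add: z_def)
  qed
  moreover have "S \<subseteq> K" using less by (auto simp: K_def)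
  ultimately have hull: "convex hull S \<subseteq> K" by (rule hull_minimal[rotated])
  have "closed_segment u v = convex hull {u, v}" by (simp add: segment_convex_hull)
  then have "closed_segment u v \<subseteq> convex hull S"
    using uv by (simp add: hull_mono)
  moreover have "x \<in> closed_segment u v \<and> y \<in> closed_segment u v"
    if x: "x \<in> convex hull S" and y: "y \<in> convex hull S"
      and z: "z \<in> closed_segment u v" "z \<in> open_segment x y" for x y z
  proof -
    from z obtain t where t: "0 < t" "t < 1" "z = (1 - t) *\<^sub>R x + t *\<^sub>R y"
      by (auto simp: in_segment)
    have "f x \<le> c" "f y \<le> c" using hull x y K(1) by auto
    moreover have "c = (1 - t) * f x + t * f y"
      using seg[OF z(1)] t by (simp add: add scaleR)
    then have "(1 - t) * (c - f x) + t * (c - f y) = 0" by (simp add: algebra_simps)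
    moreover have "(1 - t) * (c - f x) \<ge> 0" "t * (c - f y) \<ge> 0" using t calculation by auto
    ultimately have "(1 - t) * (c - f x) = 0" "t * (c - f y) = 0" by linarith+
    then have "f x = c" "f y = c" using t by auto
    then show ?thesis
      using K(2) hull x y by blast
  qed
  ultimately show ?thesis
    unfolding face_of_def by (meson convex_closed_segment)
qed

lemma is_edge_of_closed_segment_iff:
  "is_edge_of (closed_segment u v) P \<longleftrightarrow> closed_segment u v face_of P" if "u \<noteq> v"
proof -
  have "affine hull {u, v} = affine hull closed_segment u v"
    by (simp add: segment_convex_hull affine_hull_convex_hull)
  then show ?thesis
    using that affine_independent_2[of u v] card_2_iff[of "{u, v}"]
    unfolding is_edge_of_def by blast
qed

lemma l2_dist_indicator_vec:
  assumes "finite A" "finite B" "finite E"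
  shows "l2_dist E (indicator_vec A) (indicator_vec B) = sqrt (card (E \<inter> sym_diff A B))"
proof -
  have "(\<Sum>e\<in>E. (indicator A e - indicator B e :: real)\<^sup>2) = (\<Sum>e\<in>E. indicator (sym_diff A B) e)"
    by (intro sum.cong) (auto simp: indicator_def)
  also have "\<dots> = (\<Sum>e\<in>E \<inter> sym_diff A B. 1)"
    using assms(3) by (intro sum.mono_neutral_cong_right) (auto simp: indicator_def)
  finally show ?thesis
    using assms by (simp add: l2_dist_def L2_set_def lookup_indicator_vec)
qed

section \<open>Cycles and circuits\<close>

lemma cycle_triangle:
  assumes "ends x = {u, v}" "ends y = {v, w}" "ends z = {w, u}" "distinct [u, v, w]"
  shows "cycle ends {x, y, z}"
  unfolding cycle_def
  using assms
  by (intro exI[of _ "[u, v, w]"] exI[of _ "[x, y, z]"])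
     (auto simp: less_Suc_eq doubleton_eq_iff)

lemma cycle_quadrilateral:
  assumes "ends w = {a, b}" "ends x = {b, c}" "ends y = {c, d}" "ends z = {d, a}"
    "distinct [a, b, c, d]"
  shows "cycle ends {w, x, y, z}"
  unfolding cycle_def
  using assms
  by (intro exI[of _ "[a, b, c, d]"] exI[of _ "[w, x, y, z]"])
     (auto simp: less_Suc_eq doubleton_eq_iff)

lemma cycle_nonempty: "cycle ends C \<Longrightarrow> C \<noteq> {}"
  by (auto simp: cycle_def)

text \<open>Two consecutive edges of a cycle meet at each of its vertices. This serves to prove
  acyclicity: a non-loop edge with an endpoint that no other edge touches lies on no cycle.\<close>

lemma cycle_no_leaf:
  assumes "cycle ends C" "e \<in> C" "v \<in> ends e" "card (ends e) \<noteq> 1"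
  obtains e' where "e' \<in> C" "e' \<noteq> e" "v \<in> ends e'"
proof -
  obtain vs es where *: "vs \<noteq> []" "length es = length vs" "distinct es" "set es = C"
    "\<And>i. i < length vs \<Longrightarrow> ends (es ! i) = {vs ! i, vs ! (Suc i mod length vs)}"
    using assms(1) unfolding cycle_def by blast
  let ?k = "length vs"
  obtain i where i: "i < ?k" "e = es ! i"
    using assms(2) * by (metis in_set_conv_nth)
  have k: "?k \<noteq> 1"
    using *(5)[OF i(1)] i assms(4) by auto
  then have k2: "2 \<le> ?k" using *(1) by (cases vs) (auto simp: Suc_le_eq)
  have inj: "es ! j \<noteq> e" if "j < ?k" "j \<noteq> i" for j
    using that i * by (simp add: nth_eq_iff_index_eq)
  consider "v = vs ! i" | "v = vs ! (Suc i mod ?k)"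
    using *(5)[OF i(1)] i assms(3) by auto
  then show ?thesis
  proof cases
    case 1
    \<comment> \<open>Here \<open>v\<close> is the vertex where \<open>es ! i\<close> starts, so the
      other edge at \<open>v\<close> is the cyclic predecessor.\<close>
    define j where "j = (if i = 0 then ?k - 1 else i - 1)"
    have "j < ?k" "j \<noteq> i" "Suc j mod ?k = i"
      using k2 i by (auto simp: j_def)
    then show ?thesis
      using that[of "es ! j"] *(2,4) *(5)[of j] inj[of j] 1 by fastforce
  next
    case 2
    define j where "j = Suc i mod ?k"
    have "j < ?k" "j \<noteq> i"
      using k2 i by (auto simp: j_def mod_Suc)
    then show ?thesis
      using that[of "es ! j"] *(2,4) *(5)[of j] inj[of j] 2 by (auto simp: j_def)
  qed
qed

text \<open>Length 1 would be a loop and length 2 a pair of parallel edges.\<close>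

lemma card_cycle_ge_3:
  assumes "cycle ends C" "C \<subseteq> E" "inj_on ends E" "\<And>e. e \<in> E \<Longrightarrow> card (ends e) = 2"
  shows "3 \<le> card C"
proof -
  obtain vs es where *: "vs \<noteq> []" "length es = length vs" "distinct es" "set es = C"
    "\<And>i. i < length vs \<Longrightarrow> ends (es ! i) = {vs ! i, vs ! (Suc i mod length vs)}"
    using assms(1) unfolding cycle_def by blast
  have C: "es ! i \<in> E" if "i < length vs" for i
    using that * assms(2) by auto
  have "length vs \<noteq> 1"
  proof
    assume one: "length vs = 1"
    then have "card (ends (es ! 0)) = 1" using *(5)[of 0] by simp
    then show False using assms(4)[OF C, of 0] one by simp
  qed
  moreover have "length vs \<noteq> 2"
  proof
    assume two: "length vs = 2"
    have "ends (es ! 0) = ends (es ! 1)"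
      using *(5)[of 0] *(5)[of 1] two by auto
    then have "es ! 0 = es ! 1"
      using C[of 0] C[of 1] two assms(3) by (simp add: inj_on_eq_iff)
    then show False
      using *(2,3) two by (simp add: nth_eq_iff_index_eq)
  qed
  moreover have "card C = length vs"
    using * distinct_card by metis
  moreover have "length vs \<noteq> 0" using *(1) by simp
  ultimately show ?thesis by linarith
qed

definition forests :: "'e set \<Rightarrow> ('e \<Rightarrow> 'v set) \<Rightarrow> 'e set set" where
  "forests E ends = {F. F \<subseteq> E \<and> forest ends F}"

lemma circuit_forests_imp_cycle:
  assumes "circuit E (forests E ends) C"
  shows "cycle ends C"
proof -
  obtain D where "D \<subseteq> C" "cycle ends D"
    using assms by (auto simp: circuit_def forests_def forest_def)
  moreover have "D \<notin> forests E ends"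
    using \<open>cycle ends D\<close> by (auto simp: forests_def forest_def)
  ultimately show ?thesis
    using assms by (auto simp: circuit_def psubset_eq)
qed

text \<open>A proper subset of a triangle has fewer edges than any cycle of a simple graph.\<close>

lemma circuit_if_cycle_card_3:
  assumes "cycle ends C" "C \<subseteq> E" "card C = 3"
    and simple: "inj_on ends E" "\<And>e. e \<in> E \<Longrightarrow> card (ends e) = 2"
  shows "circuit E (forests E ends) C"
  unfolding circuit_def
proof (intro conjI allI impI)
  show "C \<notin> forests E ends"
    using assms by (auto simp: forests_def forest_def)
  fix D assume D: "D \<subset> C"
  have "finite C" using assms(3) card.infinite by fastforce
  have False if "cycle ends D'" "D' \<subseteq> D" for D'
  proof -
    have "card D' < card C"
      using that D \<open>finite C\<close> by (intro psubset_card_mono) auto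
    moreover have "3 \<le> card D'"
      using that D assms(2) by (intro card_cycle_ge_3[OF _ _ simple]) auto
    ultimately show False using assms(3) by simp
  qed
  then show "D \<in> forests E ends"
    using D assms(2) by (auto simp: forests_def forest_def)
qed (use assms in auto)

section \<open>A wheel of triangles\<close>

locale triangle_wheel =
  fixes m p :: nat
  assumes m: "2 \<le> m" and mp: "m \<le> p"
begin

text \<open>The hub is \<open>0\<close> and the \<open>i\<close>-th pair is \<open>2i+1\<close>, \<open>2i+2\<close>. The edges \<open>t\<^sub>i\<close>, \<open>s\<^sub>i\<close>, \<open>a\<^sub>i\<close>, \<open>b\<^sub>i\<close>
  are \<open>i\<close>, \<open>p + i\<close>, \<open>p + m + i\<close>, \<open>p + 2m + i\<close>. The isolated edges \<open>t\<^sub>i\<close> with \<open>m \<le> i < p\<close> are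
  coloops that pad the ground set to an arbitrary size.\<close>

definition next_spoke :: "nat \<Rightarrow> nat" where
  "next_spoke i = Suc i mod m"

definition ends :: "nat \<Rightarrow> nat set" where
  "ends e =
    (if e < p then {2 * e + 1, 2 * e + 2}
     else if e < p + m then {2 * (e - p) + 1, 2 * next_spoke (e - p) + 2}
     else if e < p + 2 * m then {0, 2 * (e - (p + m)) + 1}
     else {0, 2 * (e - (p + 2 * m)) + 2})"

definition E where "E = {..<p + 3 * m}"
definition T where "T = {..<p}"
definition A where "A = {p + m..<p + 2 * m}"
definition B where "B = {p + 2 * m..<p + 3 * m}"

abbreviation I where "I \<equiv> forests E ends"

text \<open>The numbering puts \<open>T\<close> below all other edges and every \<open>p + i\<close>
  with \<open>i < m\<close> below all spokes, so the order of the natural numbers is the intended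
  one.\<close>

definition r where "r = {(x, y). x \<in> E \<and> y \<in> E \<and> x \<le> y}"

lemma next_spoke: "next_spoke i < m" "i < m \<Longrightarrow> next_spoke i \<noteq> i"
  using m mod_less_divisor[of m "Suc i"] by (auto simp: next_spoke_def mod_Suc)

lemma next_spoke_eq_iff: "i < m \<Longrightarrow> j < m \<Longrightarrow> next_spoke i = next_spoke j \<longleftrightarrow> i = j"
  by (auto simp: next_spoke_def mod_Suc split: if_splits)

lemma ends_simps:
  "i < p \<Longrightarrow> ends i = {2 * i + 1, 2 * i + 2}"
  "i < m \<Longrightarrow> ends (p + i) = {2 * i + 1, 2 * next_spoke i + 2}"
  "i < m \<Longrightarrow> ends (p + m + i) = {0, 2 * i + 1}"
  "i < m \<Longrightarrow> ends (p + 2 * m + i) = {0, 2 * i + 2}"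
  by (auto simp: ends_def)

lemma A_cases:
  assumes "e \<in> A" obtains i where "i < m" "e = p + m + i"
  using assms that[of "e - (p + m)"] by (auto simp: A_def)

lemma B_cases:
  assumes "e \<in> B" obtains i where "i < m" "e = p + 2 * m + i"
  using assms that[of "e - (p + 2 * m)"] by (auto simp: B_def)

lemma E_cases [consumes 1, case_names T S A B]:
  assumes "e \<in> E"
  obtains "e < p" | i where "i < m" "e = p + i" | i where "i < m" "e = p + m + i"
    | i where "i < m" "e = p + 2 * m + i"
proof -
  have "e < p \<or> (\<exists>i<m. e = p + i) \<or> e \<in> A \<or> e \<in> B"
    using assms unfolding E_def A_def B_def by simp presburger
  then show ?thesis using that A_cases B_cases by metis
qed

lemma in_sets [simp]:
  "i < p \<Longrightarrow> i \<in> T" "i < m \<Longrightarrow> i \<in> T" "i < m \<Longrightarrow> p + m + i \<in> A" "i < m \<Longrightarrow> p + 2 * m + i \<in> B"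
  using mp by (auto simp: T_def A_def B_def)

lemma subset_E: "T \<subseteq> E" "A \<subseteq> E" "B \<subseteq> E" "i < m \<Longrightarrow> p + i \<in> E"
  by (auto simp: E_def T_def A_def B_def)

lemma card_ends: "e \<in> E \<Longrightarrow> card (ends e) = 2"
  by (erule E_cases)
     (auto simp: ends_simps card_insert_if double_not_eq_Suc_double)

text \<open>What keeps \<open>p + i\<close> from being parallel to \<open>i\<close> is
  \<open>next_spoke i \<noteq> i\<close>, which rests on \<open>2 \<le> m\<close>.\<close>

lemma inj_ends: "inj_on ends E"
proof (rule inj_onI)
  fix x y assume "x \<in> E" and y: "y \<in> E" and eq: "ends x = ends y"
  note [simp] = ends_simps doubleton_eq_iff next_spoke_eq_iff next_spoke(2) next_spoke(2)[symmetric]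
    Suc_double_not_eq_double double_not_eq_Suc_double
  from \<open>x \<in> E\<close> show "x = y"
    by (cases rule: E_cases; insert eq; cases rule: E_cases[OF y]) auto
qed

lemma graphic_matroid_I: "graphic_matroid E I"
proof -
  have "graph (\<Union>e\<in>E. ends e) E ends"
    unfolding graph_def using card_ends by (auto simp: E_def ends_def)
  then show ?thesis
    unfolding graphic_matroid_def forests_def by blast
qed

lemma linear_order_r: "linear_order_on E r"
  by (auto simp: r_def linear_order_on_def partial_order_on_def preorder_on_def refl_on_def
      trans_def antisym_def total_on_def)

section \<open>NBC bases of the wheel\<close>

lemma cycle_no_leaf':
  assumes "cycle ends C" "C \<subseteq> E" "e \<in> C" "v \<in> ends e"
  obtains e' where "e' \<in> C" "e' \<noteq> e" "v \<in> ends e'"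
  using assms card_ends cycle_no_leaf[of ends C e v] by (metis Suc_1 n_not_Suc_n subsetD)

text \<open>By \<open>leaf\<close>, \<open>X\<close> together with any single edge is acyclic; by
  \<open>closes\<close>, \<open>T \<union> X\<close> is maximal. A circuit breaking into
  \<open>T \<union> X\<close> must have its least edge outside the initial segment \<open>T\<close>,
  so it avoids \<open>T\<close> and is a cycle in \<open>X\<close> plus one edge.\<close>

lemma nbc_basis_Un:
  assumes "X \<subseteq> E" "X \<inter> T = {}"
    and leaf: "\<And>e. e \<in> E \<Longrightarrow> \<exists>v\<in>ends e. \<forall>x\<in>X - {e}. v \<notin> ends x"
    and closes: "\<And>e. e \<in> E \<Longrightarrow> e \<notin> T \<Longrightarrow> e \<notin> X \<Longrightarrow> \<exists>C. C \<subseteq> insert e (T \<union> X) \<and> cycle ends C"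
  shows "nbc_basis E I r (T \<union> X)"
proof -
  have no_cycle: "e \<notin> C" if "cycle ends C" "C \<subseteq> insert e X" "e \<in> E" for C e
  proof
    assume "e \<in> C"
    obtain v where v: "v \<in> ends e" "\<forall>x\<in>X - {e}. v \<notin> ends x"
      using leaf \<open>e \<in> E\<close> by blast
    have "C \<subseteq> E" using that assms(1) by auto
    with that v \<open>e \<in> C\<close> obtain e' where "e' \<in> C" "e' \<noteq> e" "v \<in> ends e'"
      by (meson cycle_no_leaf')
    then show False using v that by auto
  qed
  have TX: "T \<union> X \<subseteq> E" using assms(1) subset_E by simp
  have "False" if C: "cycle ends C" "C \<subseteq> T \<union> X" for C
  proof -
    \<comment> \<open>\<open>X\<close> misses the endpoint \<open>v\<close>, so the next edge of the
      cycle at \<open>v\<close> would be in \<open>T\<close>; but \<open>T\<close> is a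
      matching.\<close>
    have "t \<notin> C" if "t \<in> T" for t
    proof
      assume "t \<in> C"
      obtain v where v: "v \<in> ends t" "\<forall>x\<in>X - {t}. v \<notin> ends x"
        using leaf \<open>t \<in> T\<close> subset_E by blast
      then obtain e where e: "e \<in> C" "e \<noteq> t" "v \<in> ends e"
        using cycle_no_leaf' C TX \<open>t \<in> C\<close> by (metis subset_trans)
      then have "e \<in> T" using v C by auto
      with that e v show False
        by (auto simp: T_def ends_simps; presburger)
    qed
    then have "C \<subseteq> X" using C by auto
    then show False
      using no_cycle[of C] C cycle_nonempty assms(1) by blast
  qed
  then have forest: "forest ends (T \<union> X)" by (auto simp: forest_def)
  have "basis I (T \<union> X)"
    unfolding basis_def
  proof (intro conjI ballI impI)
    show "T \<union> X \<in> I" using forest TX by (auto simp: forests_def)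
    fix F assume F: "F \<in> I" "T \<union> X \<subseteq> F"
    have False if "e \<in> F" "e \<notin> T \<union> X" for e
    proof -
      have "e \<in> E" using that F by (auto simp: forests_def)
      with that obtain C where "C \<subseteq> insert e (T \<union> X)" "cycle ends C"
        using closes[of e] by auto
      then show False
        using F that unfolding forests_def forest_def by blast
    qed
    then show "F = T \<union> X" using F by blast
  qed
  moreover have False if "broken_circuit E I r S" "S \<subseteq> T \<union> X" for S
  proof -
    obtain C e where C: "circuit E I C" "e \<in> C" "\<forall>f\<in>C. (e, f) \<in> r" "S = C - {e}"
      using \<open>broken_circuit E I r S\<close> unfolding broken_circuit_def by blast
    have cycle: "cycle ends C" using C(1) by (rule circuit_forests_imp_cycle)
    have "C \<subseteq> E" using C(1) by (auto simp: circuit_def)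
    have e: "e \<notin> T \<union> X"
      using cycle C that forest unfolding forest_def by blast
    \<comment> \<open>\<open>e \<notin> T\<close> means \<open>p \<le> e\<close>, and
      \<open>e\<close> is least in \<open>C\<close>, so \<open>C\<close> is disjoint from
      \<open>T\<close>.\<close>
    have "C \<subseteq> insert e X"
      using e C that by (force simp: r_def T_def)
    then show False
      using no_cycle[OF cycle] C \<open>C \<subseteq> E\<close> by blast
  qed
  ultimately show ?thesis unfolding nbc_basis_def by blast
qed

lemma triangles:
  assumes "i < m"
  shows "cycle ends {i, p + m + i, p + 2 * m + i}"
    and "cycle ends {p + i, p + m + i, p + 2 * m + next_spoke i}"
proof -
  show "cycle ends {i, p + m + i, p + 2 * m + i}"
    using assms mp cycle_triangle[of ends "p + m + i" 0 "2 * i + 1" i "2 * i + 2" "p + 2 * m + i"]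
    by (simp add: ends_simps insert_commute)
  show "cycle ends {p + i, p + m + i, p + 2 * m + next_spoke i}"
    using assms next_spoke(1)[of i] Suc_double_not_eq_double double_not_eq_Suc_double
      cycle_triangle[of ends "p + m + i" 0 "2 * i + 1" "p + i" "2 * next_spoke i + 2" "p + 2 * m + next_spoke i"]
    by (simp add: ends_simps insert_commute)
qed

text \<open>These are the fundamental circuits of \<open>p + i\<close> with respect to
  \<open>T \<union> A\<close> and \<open>T \<union> B\<close>; they yield maximality of
  both.\<close>

lemma quadrilaterals:
  assumes "i < m"
  shows "cycle ends {p + m + i, p + i, next_spoke i, p + m + next_spoke i}"
    and "cycle ends {p + 2 * m + i, i, p + i, p + 2 * m + next_spoke i}"
proof -
  have *: "next_spoke i < m" "next_spoke i < p" "i < p" "next_spoke i \<noteq> i"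
    using next_spoke[of i] assms mp by auto
  show "cycle ends {p + m + i, p + i, next_spoke i, p + m + next_spoke i}"
    by (rule cycle_quadrilateral[of _ _ 0 "2 * i + 1" _ "2 * next_spoke i + 2" _ "2 * next_spoke i + 1"])
       (use assms * in \<open>auto simp: ends_simps Suc_double_not_eq_double double_not_eq_Suc_double\<close>)
  show "cycle ends {p + 2 * m + i, i, p + i, p + 2 * m + next_spoke i}"
    by (rule cycle_quadrilateral[of _ _ 0 "2 * i + 2" _ "2 * i + 1" _ "2 * next_spoke i + 2"])
       (use assms * in \<open>auto simp: ends_simps Suc_double_not_eq_double double_not_eq_Suc_double\<close>)
qed

lemma nbc_basis_A: "nbc_basis E I r (T \<union> A)"
proof (rule nbc_basis_Un)
  show "A \<subseteq> E" "A \<inter> T = {}" by (auto simp: E_def A_def T_def)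
  show "\<exists>v\<in>ends e. \<forall>x\<in>A - {e}. v \<notin> ends x" if "e \<in> E" for e
  proof -
    \<comment> \<open>\<open>A\<close> meets only the hub and odd vertices, so an edge outside
      \<open>A\<close> has its nonzero even endpoint free.\<close>
    have even: "v \<notin> ends x" if "even v" "v \<noteq> 0" "x \<in> A" for v x
      using that by (auto simp: ends_simps elim!: A_cases)
    from \<open>e \<in> E\<close> show ?thesis
    proof (cases rule: E_cases)
      case T
      then show ?thesis by (intro bexI[of _ "2 * e + 2"]) (auto simp: even T_def ends_simps)
    next
      case (S i)
      then show ?thesis by (intro bexI[of _ "2 * next_spoke i + 2"]) (auto simp: even ends_simps)
    next
      case (A i)
      then show ?thesis
        by (intro bexI[of _ "2 * i + 1"]) (auto simp: ends_simps elim!: A_cases)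
    next
      case (B i)
      then show ?thesis by (intro bexI[of _ "2 * i + 2"]) (auto simp: even ends_simps)
    qed
  qed
  show "\<exists>C. C \<subseteq> insert e (T \<union> A) \<and> cycle ends C" if "e \<in> E" "e \<notin> T" "e \<notin> A" for e
    using \<open>e \<in> E\<close>
  proof (cases rule: E_cases)
    case (S i)
    then show ?thesis
      using quadrilaterals(1)[of i] next_spoke(1)[of i]
      by (intro exI[of _ "{p + m + i, p + i, next_spoke i, p + m + next_spoke i}"]) auto
  next
    case (B i)
    then show ?thesis
      using triangles(1)[of i] by (intro exI[of _ "{i, p + m + i, p + 2 * m + i}"]) auto
  qed (use that in auto)
qed

lemma nbc_basis_B: "nbc_basis E I r (T \<union> B)"
proof (rule nbc_basis_Un)
  show "B \<subseteq> E" "B \<inter> T = {}" by (auto simp: E_def B_def T_def)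
  show "\<exists>v\<in>ends e. \<forall>x\<in>B - {e}. v \<notin> ends x" if "e \<in> E" for e
  proof -
    \<comment> \<open>\<open>B\<close> meets no odd vertex, so an edge outside \<open>B\<close> has
      its odd endpoint free.\<close>
    have odd: "2 * i + 1 \<notin> ends x" if "x \<in> B" for i x
      using that by (auto simp: ends_simps elim!: B_cases; presburger)
    from \<open>e \<in> E\<close> show ?thesis
    proof (cases rule: E_cases)
      case T
      then show ?thesis using odd by (intro bexI[of _ "2 * e + 1"]) (auto simp: T_def ends_simps)
    next
      case (S i)
      then show ?thesis using odd by (intro bexI[of _ "2 * i + 1"]) (auto simp: ends_simps)
    next
      case (A i)
      then show ?thesis using odd by (intro bexI[of _ "2 * i + 1"]) (auto simp: ends_simps)
    next
      case (B i)
      then show ?thesis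
        by (intro bexI[of _ "2 * i + 2"]) (auto simp: ends_simps elim!: B_cases)
    qed
  qed
  show "\<exists>C. C \<subseteq> insert e (T \<union> B) \<and> cycle ends C" if "e \<in> E" "e \<notin> T" "e \<notin> B" for e
    using \<open>e \<in> E\<close>
  proof (cases rule: E_cases)
    case (S i)
    then show ?thesis
      using quadrilaterals(2)[of i] next_spoke(1)[of i]
      by (intro exI[of _ "{p + 2 * m + i, i, p + i, p + 2 * m + next_spoke i}"]) auto
  next
    case (A i)
    then show ?thesis
      using triangles(1)[of i] by (intro exI[of _ "{i, p + m + i, p + 2 * m + i}"]) auto
  qed (use that in auto)
qed

text \<open>The first set is a cycle; the second is a triangle without its least edge
  \<open>p + i\<close>, hence a broken circuit.\<close>

lemma nbc_basis_spokes:
  assumes D: "nbc_basis E I r D" and i: "i < m"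
  shows "\<not> {i, p + m + i, p + 2 * m + i} \<subseteq> D"
    and "\<not> {p + m + i, p + 2 * m + next_spoke i} \<subseteq> D"
proof -
  show "\<not> {i, p + m + i, p + 2 * m + i} \<subseteq> D"
    using triangles(1)[OF i] D
    unfolding nbc_basis_def basis_def forests_def forest_def by blast
  let ?C = "{p + i, p + m + i, p + 2 * m + next_spoke i}"
  have less: "p + i < p + m + i" "p + i < p + 2 * m + next_spoke i" "p + m + i < p + 2 * m + next_spoke i"
    using i by auto
  have "?C \<subseteq> E" using i next_spoke(1)[of i] by (auto simp: E_def)
  moreover have "card ?C = 3" using less by simp
  ultimately have "circuit E I ?C"
    using triangles(2)[OF i] inj_ends card_ends by (intro circuit_if_cycle_card_3) auto
  moreover have "\<forall>f\<in>?C. (p + i, f) \<in> r"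
    using \<open>?C \<subseteq> E\<close> less by (auto simp: r_def)
  ultimately have "broken_circuit E I r (?C - {p + i})"
    unfolding broken_circuit_def by blast
  moreover have "?C - {p + i} = {p + m + i, p + 2 * m + next_spoke i}"
    using less by auto
  ultimately show "\<not> {p + m + i, p + 2 * m + next_spoke i} \<subseteq> D"
    using D unfolding nbc_basis_def by auto
qed

section \<open>The linear functional exposing the edge\<close>

text \<open>The weight 2 on \<open>t\<^sub>i\<close> makes \<open>{a\<^sub>i, b\<^sub>i}\<close> worse than \<open>t\<^sub>i\<close> with one spoke.\<close>

definition objective :: "(nat \<Rightarrow>\<^sub>0 real) \<Rightarrow> real" where
  "objective x =
    (\<Sum>i<m. 2 * Poly_Mapping.lookup x i + Poly_Mapping.lookup x (p + m + i)
        + Poly_Mapping.lookup x (p + 2 * m + i) - Poly_Mapping.lookup x (p + i))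
    + (\<Sum>i=m..<p. Poly_Mapping.lookup x i)"

lemma linear_objective: "linear objective"
proof (rule linearI)
  have [simp]: "Poly_Mapping.lookup (c *\<^sub>R x) i = c * Poly_Mapping.lookup x i"
    for c :: real and x :: "nat \<Rightarrow>\<^sub>0 real" and i
  proof -
    have "finite {i. c * Poly_Mapping.lookup x i \<noteq> 0}"
      by (rule finite_subset[OF _ finite_lookup[of x]]) auto
    then show ?thesis by (simp add: scaleR_poly_mapping_def)
  qed
  show "objective (c *\<^sub>R x) = c *\<^sub>R objective x" for c x
    unfolding objective_def by (simp add: sum_distrib_left algebra_simps)
  show "objective (x + y) = objective x + objective y" for x y
    unfolding objective_def
    by (simp add: lookup_add sum.distrib sum_subtractf algebra_simps flip: sum_distrib_left)
qed

lemma objective_A: "objective (indicator_vec (T \<union> A)) = (\<Sum>i<m. 3) + (\<Sum>i=m..<p. 1)"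
  using mp unfolding objective_def
  by (intro arg_cong2[of _ _ _ _ "(+)"] sum.cong)
     (auto simp: lookup_indicator_vec T_def A_def)

lemma objective_B: "objective (indicator_vec (T \<union> B)) = (\<Sum>i<m. 3) + (\<Sum>i=m..<p. 1)"
  using mp unfolding objective_def
  by (intro arg_cong2[of _ _ _ _ "(+)"] sum.cong)
     (auto simp: lookup_indicator_vec T_def B_def)

lemma all_spokes:
  assumes "\<And>i. i < m \<Longrightarrow> P i \<Longrightarrow> P (next_spoke i)" "k < m" "P k" "i < m"
  shows "P i"
proof -
  have "P ((k + j) mod m)" for j
  proof (induction j)
    case (Suc j)
    then show ?case
      using assms(1)[of "(k + j) mod m"] m by (simp add: next_spoke_def mod_Suc_eq)
  qed (use assms in simp)
  \<comment> \<open>\<open>k + (m - k + i) = m + i\<close>, which is \<open>i\<close> modulo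
    \<open>m\<close>.\<close>
  from this[of "m - k + i"] show ?thesis using assms by simp
qed

text \<open>The bound holds term by term, so reaching it makes every term tight; this fixes
  \<open>D\<close> up to the choice of one spoke per pair.\<close>

lemma objective_less:
  assumes D: "nbc_basis E I r D" "D \<noteq> T \<union> A" "D \<noteq> T \<union> B"
  shows "objective (indicator_vec D) < (\<Sum>i<m. 3) + (\<Sum>i=m..<p. 1)"
proof (rule ccontr)
  have "D \<subseteq> E" using D(1) by (auto simp: nbc_basis_def basis_def forests_def)
  then have "finite D" using finite_subset by (auto simp: E_def)
  let ?g = "\<lambda>i. 2 * indicator D i + indicator D (p + m + i) + indicator D (p + 2 * m + i)
    - indicator D (p + i) :: real"
  assume "\<not> objective (indicator_vec D) < (\<Sum>i<m. 3) + (\<Sum>i=m..<p. 1)"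
  then have ge: "(\<Sum>i<m. 3) + (\<Sum>i=m..<p. 1) \<le> (\<Sum>i<m. ?g i) + (\<Sum>i=m..<p. indicator D i)"
    by (simp add: objective_def lookup_indicator_vec \<open>finite D\<close>)
  \<comment> \<open>The value 4 would need \<open>i\<close> and both spokes, which form a
    triangle.\<close>
  have g: "?g i \<le> 3" if "i < m" for i
    using nbc_basis_spokes(1)[OF D(1) that] by (auto simp: indicator_def)
  have h: "indicator D i \<le> (1 :: real)" for i by (simp add: indicator_def)
  have "(\<Sum>i<m. ?g i) \<le> (\<Sum>i<m. 3)" using g by (intro sum_mono) auto
  moreover have "(\<Sum>i=m..<p. indicator D i) \<le> (\<Sum>i=m..<p. 1 :: real)" using h by (intro sum_mono)
  ultimately have sums: "(\<Sum>i<m. ?g i) = (\<Sum>i<m. 3)"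
    "(\<Sum>i=m..<p. indicator D i) = (\<Sum>i=m..<p. 1 :: real)"
    using ge by linarith+
  have "?g i = 3" if "i < m" for i
    using sum_mono_inv[OF sums(1), of i] g that by auto
  \<comment> \<open>Besides \<open>i\<close> with one spoke and without \<open>p + i\<close>, the
    value 3 arises only from \<open>i\<close>, both spokes and \<open>p + i\<close>, which contains
    a triangle.\<close>
  then have spoke: "i \<in> D" "p + i \<notin> D" "p + m + i \<in> D \<longleftrightarrow> p + 2 * m + i \<notin> D" if "i < m" for i
    using \<open>\<And>i. i < m \<Longrightarrow> ?g i = 3\<close>[OF that] nbc_basis_spokes(1)[OF D(1) that]
    by (auto simp: indicator_def of_bool_def split: if_splits)
  have "i \<in> D" if "i \<in> {m..<p}" for i
    using sum_mono_inv[OF sums(2) _ that] h by (auto simp: indicator_def split: if_splits)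
  with spoke(1) have T: "T \<subseteq> D"
    unfolding T_def by (metis atLeastLessThan_iff lessThan_iff not_le_imp_less subsetI)
  \<comment> \<open>The broken circuit excludes the other spoke of the next pair, and one of the two
    must be present.\<close>
  have step: "p + m + next_spoke i \<in> D" if "i < m" "p + m + i \<in> D" for i
    using nbc_basis_spokes(2)[OF D(1) that(1)] that spoke(3) next_spoke(1) by auto
  have D_iff: "D = T \<union> X" if "X \<subseteq> E" and X: "\<And>i. i < m \<Longrightarrow> p + i \<notin> X"
    "\<And>i. i < m \<Longrightarrow> p + m + i \<in> D \<longleftrightarrow> p + m + i \<in> X"
    "\<And>i. i < m \<Longrightarrow> p + 2 * m + i \<in> D \<longleftrightarrow> p + 2 * m + i \<in> X" for X
  proof -
    have "e \<in> D \<longleftrightarrow> e \<in> T \<union> X" if "e \<in> E" for e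
      using that
    proof (cases rule: E_cases)
      case S
      then show ?thesis using spoke(2) X(1) by (auto simp: T_def)
    next
      case A
      then show ?thesis using X(2) by (auto simp: T_def)
    next
      case B
      then show ?thesis using X(3) by (auto simp: T_def)
    qed (use T in auto)
    then show ?thesis using \<open>D \<subseteq> E\<close> \<open>X \<subseteq> E\<close> subset_E(1) by blast
  qed
  show False
  proof (cases "\<exists>k<m. p + m + k \<in> D")
    case True
    then have "p + m + i \<in> D" if "i < m" for i
      using all_spokes[of "\<lambda>i. p + m + i \<in> D"] step that by blast
    then have "D = T \<union> A"
      using spoke(3) by (intro D_iff subset_E) (auto simp: A_def)
    then show False using D by simp
  next
    case False
    then have "D = T \<union> B"
      using spoke(3) by (intro D_iff subset_E) (auto simp: B_def)
    then show False using D by simp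
  qed
qed

lemma is_edge_of_nbc_polytope:
  "is_edge_of (closed_segment (indicator_vec (T \<union> A)) (indicator_vec (T \<union> B))) (nbc_polytope E I r)"
proof -
  \<comment> \<open>The spoke \<open>p + m\<close> tells the two bases apart.\<close>
  have "p + m \<in> T \<union> A" "p + m \<notin> T \<union> B" "finite (T \<union> A)" "finite (T \<union> B)"
    using m by (auto simp: T_def A_def B_def)
  then have "indicator_vec (T \<union> A) \<noteq> indicator_vec (T \<union> B)"
    using lookup_indicator_vec[of "T \<union> A" "p + m"] lookup_indicator_vec[of "T \<union> B" "p + m"]
    by (metis indicator_eq_0_iff)
  moreover have "closed_segment (indicator_vec (T \<union> A)) (indicator_vec (T \<union> B)) face_of nbc_polytope E I r"
    unfolding nbc_polytope_def
    using nbc_basis_A nbc_basis_B objective_less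
    by (intro closed_segment_face_of_convex_hull[OF linear_objective _ _ objective_A objective_B]) auto
  ultimately show ?thesis by (simp add: is_edge_of_closed_segment_iff)
qed

lemma l2_dist_A_B: "l2_dist E (indicator_vec (T \<union> A)) (indicator_vec (T \<union> B)) = sqrt (2 * m)"
proof -
  have "E \<inter> sym_diff (T \<union> A) (T \<union> B) = {p + m..<p + 3 * m}"
    by (auto simp: E_def T_def A_def B_def)
  then show ?thesis
    by (subst l2_dist_indicator_vec) (auto simp: E_def T_def A_def B_def)
qed

end

theorem theorem1p11:
  shows "\<exists>c::real. c > 0 \<and> (\<exists>N::nat. \<forall>n\<ge>N.
    \<exists>(E :: nat set) I r. graphic_matroid E I \<and> card E = n \<and> linear_order_on E r \<and>
      (\<exists>u v. is_edge_of (closed_segment u v) (nbc_polytope E I r) \<and>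
             l2_dist E u v \<ge> c * sqrt (real n)))"
proof (intro exI[of _ "1 / 2 :: real"] exI[of _ "8 :: nat"] conjI allI impI)
  fix n :: nat assume n: "8 \<le> n"
  \<comment> \<open>\<open>p\<close> absorbs the remainder so that \<open>p + 3 * m = n\<close>,
    with \<open>m \<le> p\<close> because \<open>4 * m \<le> n\<close>. The bound
    \<open>8 \<le> n\<close> ensures \<open>2 \<le> m\<close>.\<close>
  define m p where "m = n div 4" and "p = n - 3 * m"
  interpret triangle_wheel m p
    using n by unfold_locales (auto simp: m_def p_def)
  have "card E = n" 
    unfolding E_def unfolding p_def m_def by simp
  moreover have "1 / 2 * sqrt (real n) \<le> sqrt (2 * m)"
  proof -
    \<comment> \<open>From \<open>n < 4 * (m + 1)\<close> and \<open>1 \<le> m\<close>. Thus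
      \<open>2 * m\<close> is at least a quarter of \<open>n\<close>, whence the constant
      \<open>1 / 2\<close>.\<close>
    have "n \<le> 8 * m" using n by (simp add: m_def)
    then have "sqrt (real n) \<le> sqrt (4 * real (2 * m))" by simp
    also have "\<dots> = 2 * sqrt (2 * m)" by (simp only: real_sqrt_mult real_sqrt_four)
    finally show ?thesis by simp
  qed
  ultimately show "\<exists>(E :: nat set) I r. graphic_matroid E I \<and> card E = n \<and> linear_order_on E r \<and>
      (\<exists>u v. is_edge_of (closed_segment u v) (nbc_polytope E I r) \<and>
             l2_dist E u v \<ge> 1 / 2 * sqrt (real n))"
    using graphic_matroid_I linear_order_r is_edge_of_nbc_polytope l2_dist_A_B by metis
qed simp

end
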